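(* Let $a=5+4q$ and $b=-4(q-1)^2$. Define $M_1(q)=L_5(q)/L_2(q)$, $M_2(q)=L_9(q)/L_4(q)$, and $M_{n+1}(q)=aM_n(q)+bM_{n-1}(q)$ for $n\geq 2$. Then for every $n\geq 1$, $$L_{4n+1}(q)=L_{2n}(q)\,M_n(q),$$ and hence $L_{4n+1}(q)$ is divisible by $L_{2n}(q)$ (as polynomials).
   Context: Define polynomials $b_n(q)$, $n\geq 1$, by $b_1(q)=1$ and $b_{2n}(q)=b_n(q)$, $b_{4n+1}(q)=q\,b_{2n}(q)+b_{2n+1}(q)$, $b_{4n+3}(q)=b_{2n+1}(q)+q\,b_{2n+2}(q)$ (for all indices for which the right-hand indices are $\geq 1$). For $n\geq 1$ let $L_n(q)=2\left(\sum_{k=1}^{2^n-1}b_k(q)\right)+b_{2^n}(q)$. *)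

theory Defs
  imports "HOL-Computational_Algebra.Computational_Algebra"
begin

abbreviation q :: "int poly" where
  "q \<equiv> [:0, 1:]"

text \<open>
  The polynomials are indexed by positive integers; the value at 0 is a dummy.
  For odd \<open>n \<ge> 3\<close> the two indices on the right are \<open>n div 2\<close> and \<open>n div 2 + 1\<close>,
  that is \<open>2k, 2k + 1\<close> for \<open>n = 4k + 1\<close> and \<open>2k + 1, 2k + 2\<close> for \<open>n = 4k + 3\<close>.
\<close>

function b_poly :: "nat \<Rightarrow> int poly" where
  "b_poly n =
    (if n = 0 then 0
     else if n = 1 then 1
     else if even n then b_poly (n div 2)
     else if n mod 4 = 1 then q * b_poly (n div 2) + b_poly (n div 2 + 1)
     else b_poly (n div 2) + q * b_poly (n div 2 + 1))"
  by auto
termination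
  by (relation "measure id") (auto elim!: oddE)

declare b_poly.simps [simp del]

lemma b_poly_1: "b_poly 1 = 1"
  by (simp add: b_poly.simps)

lemma b_poly_even: "n \<ge> 1 \<Longrightarrow> b_poly (2 * n) = b_poly n"
  by (subst b_poly.simps) auto

lemma b_poly_4n_plus_1:
  assumes "n \<ge> 1"
  shows "b_poly (4 * n + 1) = q * b_poly (2 * n) + b_poly (2 * n + 1)"
proof -
  have "(4 * n + 1) div 2 = 2 * n" "(4 * n + 1) mod 4 = 1" "odd (4 * n + 1)"
    by presburger+
  with assms show ?thesis
    by (subst b_poly.simps) simp
qed

lemma b_poly_4n_plus_3:
  "b_poly (4 * n + 3) = b_poly (2 * n + 1) + q * b_poly (2 * n + 2)"
proof -
  have "(4 * n + 3) div 2 = 2 * n + 1" "(4 * n + 3) mod 4 = 3" "odd (4 * n + 3)"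
    by presburger+
  then show ?thesis
    by (subst b_poly.simps) simp
qed

definition L_poly :: "nat \<Rightarrow> int poly" where
  "L_poly n = 2 * (\<Sum>k = 1..2 ^ n - 1. b_poly k) + b_poly (2 ^ n)"

text \<open>
  The quotients defining the first two terms are taken in the field of fractions of
  \<open>\<int>[q]\<close>, so that nothing about divisibility is presupposed. The value at 0 is a dummy.
\<close>

fun M_frac :: "nat \<Rightarrow> int poly fract" where
  "M_frac 0 = 0"
| "M_frac (Suc 0) = to_fract (L_poly 5) / to_fract (L_poly 2)"
| "M_frac (Suc (Suc 0)) = to_fract (L_poly 9) / to_fract (L_poly 4)"
| "M_frac (Suc (Suc (Suc n))) =
     to_fract (5 + 4 * q) * M_frac (Suc (Suc n)) + to_fract (- 4 * (q - 1)\<^sup>2) * M_frac (Suc n)"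

end

theory Submission
  imports Defs
begin

text \<open>
  Pair neighbouring values as \<open>(b\<^sub>k, b\<^sub>k\<^sub>+\<^sub>1)\<close> and let \<open>E\<^sub>n\<close>, \<open>O\<^sub>n\<close> be the sums of the
  even-indexed and of the odd-indexed entries over all \<open>k < 2^n\<close>. Then
  \<open>L\<^sub>n = E\<^sub>n + O\<^sub>n\<close>, and passing from \<open>k\<close> to \<open>2k\<close> and \<open>2k + 1\<close> gives
  \<open>E\<^sub>n\<^sub>+\<^sub>1 = E\<^sub>n + O\<^sub>n\<close>, \<open>O\<^sub>n\<^sub>+\<^sub>1 = 2 (q E\<^sub>n + O\<^sub>n)\<close>. Hence
  \<open>L\<^sub>n\<^sub>+\<^sub>2 = 3 L\<^sub>n\<^sub>+\<^sub>1 + 2 (q - 1) L\<^sub>n\<close>, so \<open>L\<^sub>n = U\<^sub>n\<^sub>+\<^sub>1\<close> for the Lucas sequence \<open>U\<close> with parameters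
  \<open>P = 3\<close>, \<open>Q = 2 - 2 q\<close>. The claim is the duplication formula
  \<open>U\<^sub>2\<^sub>m = U\<^sub>m V\<^sub>m\<close> at \<open>m = 2 n + 1\<close>, with \<open>M\<^sub>n = V\<^sub>2\<^sub>n\<^sub>+\<^sub>1\<close>; its recurrence has coefficients
  \<open>V\<^sub>2 = P^2 - 2 Q = 5 + 4 q\<close> and \<open>- Q^2 = - 4 (q - 1)^2\<close>.
\<close>

lemma b_poly_0: "b_poly 0 = 0"
  by (simp add: b_poly.simps)

lemma b_poly_double: "b_poly (2 * k) = b_poly k"
  by (cases "k = 0") (simp_all add: b_poly_even)

text \<open>Thanks to the dummy value at 0 this also covers the index 1.\<close>

lemma b_poly_double_plus_1:
  "b_poly (2 * k + 1) =
     (if even k then q * b_poly k + b_poly (k + 1) else b_poly k + q * b_poly (k + 1))"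
proof (cases "even k")
  case True
  then obtain m where m: "k = 2 * m" by (elim evenE)
  show ?thesis
  proof (cases "m = 0")
    case True
    with m show ?thesis by (simp add: b_poly_0 b_poly_1[unfolded One_nat_def])
  next
    case False
    with m b_poly_4n_plus_1[of m] show ?thesis by simp
  qed
next
  case False
  then obtain m where m: "k = 2 * m + 1" by (elim oddE)
  then have "2 * k + 1 = 4 * m + 3" "k + 1 = 2 * m + 2" by simp_all
  then show ?thesis
    using False b_poly_4n_plus_3[of m] by (simp only: m if_False)
qed

definition even_part :: "nat \<Rightarrow> int poly" where
  "even_part n = (\<Sum>k<2 ^ n. if even k then b_poly k else b_poly (k + 1))"

definition odd_part :: "nat \<Rightarrow> int poly" where
  "odd_part n = (\<Sum>k<2 ^ n. if even k then b_poly (k + 1) else b_poly k)"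

lemma sum_lessThan_double:
  fixes f :: "nat \<Rightarrow> 'a::comm_monoid_add"
  shows "(\<Sum>k<2 * m. f k) = (\<Sum>k<m. f (2 * k) + f (2 * k + 1))"
  by (induction m) (simp_all add: add_ac)

text \<open>Every inner term lies in two pairs and the last in one, which are the weights in
  \<open>L_poly\<close>.\<close>

lemma sum_consecutive_pairs:
  fixes f :: "nat \<Rightarrow> 'a::comm_semiring_1"
  assumes "f 0 = 0" "N \<ge> 1"
  shows "(\<Sum>k<N. f k + f (k + 1)) = 2 * (\<Sum>k = 1..N - 1. f k) + f N"
  using assms(2)
proof (induction N rule: dec_induct)
  case base
  then show ?case by (simp add: assms(1))
next
  case (step N)
  then obtain M where "N = Suc M" by (cases N) auto
  with step.IH show ?case by (simp add: algebra_simps mult_2)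
qed

lemma L_poly_eq: "L_poly n = even_part n + odd_part n"
proof -
  have "L_poly n = (\<Sum>k<2 ^ n. b_poly k + b_poly (k + 1))"
    by (simp only: L_poly_def sum_consecutive_pairs[of b_poly, OF b_poly_0] one_le_numeral one_le_power)
  also have "\<dots> = even_part n + odd_part n"
    unfolding even_part_def odd_part_def sum.distrib[symmetric]
    by (rule sum.cong) (auto simp: add.commute)
  finally show ?thesis .
qed

lemma even_part_Suc: "even_part (Suc n) = even_part n + odd_part n"
proof -
  have "even_part (Suc n) = (\<Sum>k<2 ^ n. b_poly (2 * k) + b_poly (2 * (k + 1)))"
    unfolding even_part_def power_Suc sum_lessThan_double by simp
  also have "\<dots> = even_part n + odd_part n"
    unfolding even_part_def odd_part_def sum.distrib[symmetric] b_poly_double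
    by (rule sum.cong) (auto simp: add.commute)
  finally show ?thesis .
qed

lemma odd_part_Suc: "odd_part (Suc n) = 2 * (q * even_part n + odd_part n)"
proof -
  \<comment> \<open>The pairs starting at 2k and at 2k + 1 share the odd index 2k + 1, whence the
    factor 2.\<close>
  have "odd_part (Suc n) = (\<Sum>k<2 ^ n. 2 * b_poly (2 * k + 1))"
    unfolding odd_part_def power_Suc sum_lessThan_double by simp
  also have "\<dots> = 2 * (q * even_part n + odd_part n)"
    unfolding even_part_def odd_part_def sum_distrib_left sum.distrib[symmetric]
      b_poly_double_plus_1
    by (rule sum.cong) (auto simp: algebra_simps)
  finally show ?thesis .
qed

lemma L_poly_0: "L_poly 0 = 1"
  using b_poly_1 by (simp add: L_poly_def)

lemma L_poly_1: "L_poly (Suc 0) = 3"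
  using b_poly_1 b_poly_double[of 1] by (simp add: L_poly_def)

lemma L_poly_rec: "L_poly (Suc (Suc n)) = 3 * L_poly (Suc n) + 2 * (q - 1) * L_poly n"
  unfolding L_poly_eq even_part_Suc odd_part_Suc by algebra

text \<open>At q = 1 the recurrence is geometric; nonvanishing there lets the quotients in
  \<open>M_frac\<close> be cancelled.\<close>

lemma poly_L_poly_at_1: "poly (L_poly n) 1 = 3 ^ n"
  by (induction n rule: induct_nat_012) (simp_all add: L_poly_0 L_poly_1 L_poly_rec)

lemma L_poly_nonzero: "L_poly n \<noteq> 0"
  using poly_L_poly_at_1[of n] by auto

text \<open>Addition formula for \<open>U\<close>: both sides obey the same second-order recurrence
  in m.\<close>

lemma L_poly_add:
  "L_poly (m + n + 2) = L_poly (m + 1) * L_poly (n + 1) + 2 * (q - 1) * L_poly m * L_poly n"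
proof (induction m rule: induct_nat_012)
  case 0
  show ?case by (simp add: L_poly_0 L_poly_1 L_poly_rec)
next
  case 1
  have "L_poly (Suc 0 + n + 2) = 3 * L_poly (Suc (Suc n)) + 2 * (q - 1) * L_poly (n + 1)"
    using L_poly_rec[of "n + 1"] by simp
  moreover have "L_poly (Suc 0 + 1) = 9 + 2 * (q - 1)"
    using L_poly_rec[of 0] by (simp add: L_poly_0 L_poly_1)
  ultimately show ?case
    using L_poly_rec[of n] L_poly_1 unfolding Suc_eq_plus1 by algebra
next
  case (ge2 m)
  have "L_poly (Suc (Suc m) + n + 2)
      = 3 * L_poly (Suc m + n + 2) + 2 * (q - 1) * L_poly (m + n + 2)"
    using L_poly_rec[of "m + n + 2"] by simp
  moreover have "L_poly (Suc (Suc m) + 1)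
      = 3 * L_poly (Suc m + 1) + 2 * (q - 1) * L_poly (m + 1)"
    using L_poly_rec[of "m + 1"] by simp
  ultimately show ?case
    using ge2 L_poly_rec[of m] by algebra
qed

lemma L_poly_rec_step2:
  "L_poly (m + 4) = (5 + 4 * q) * L_poly (m + 2) - 4 * (q - 1)\<^sup>2 * L_poly m"
proof -
  have "L_poly (m + 2) = 3 * L_poly (m + 1) + 2 * (q - 1) * L_poly m"
    "L_poly (m + 3) = 3 * L_poly (m + 2) + 2 * (q - 1) * L_poly (m + 1)"
    "L_poly (m + 4) = 3 * L_poly (m + 3) + 2 * (q - 1) * L_poly (m + 2)"
    using L_poly_rec[of m] L_poly_rec[of "m + 1"] L_poly_rec[of "m + 2"]
    by (simp_all add: eval_nat_numeral)
  then show ?thesis by algebra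
qed

text \<open>For k \<ge> 1 this is V(2k+1), by V(m) = U(m+1) - Q U(m-1); at k = 0 the subtraction
  truncates.\<close>

definition companion_L :: "nat \<Rightarrow> int poly" where
  "companion_L k = L_poly (2 * k + 1) + 2 * (q - 1) * L_poly (2 * k - 1)"

lemma L_poly_duplication:
  assumes "k \<ge> 1"
  shows "L_poly (4 * k + 1) = L_poly (2 * k) * companion_L k"
proof -
  obtain m where m: "2 * k = m + 1"
    using assms by (metis add.commute le_add_diff_inverse mult_2 trans_le_add1)
  \<comment> \<open>At m and m + 1 both terms of the addition formula contain
    \<open>L_poly (m + 1)\<close>.\<close>
  then have *: "4 * k + 1 = m + (m + 1) + 2" by simp
  show ?thesis
    unfolding companion_L_def * m L_poly_add[of m "m + 1"] add_diff_cancel_right' by algebra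
qed

lemma companion_L_rec:
  assumes "k \<ge> 1"
  shows "companion_L (k + 2) = (5 + 4 * q) * companion_L (k + 1) - 4 * (q - 1)\<^sup>2 * companion_L k"
proof -
  obtain m where m: "2 * k = m + 1"
    using assms by (metis add.commute le_add_diff_inverse mult_2 trans_le_add1)
  then have *: "companion_L (k + 2) = L_poly (m + 2 + 4) + 2 * (q - 1) * L_poly (m + 4)"
    "companion_L (k + 1) = L_poly (m + 2 + 2) + 2 * (q - 1) * L_poly (m + 2)"
    "companion_L k = L_poly (m + 2) + 2 * (q - 1) * L_poly m"
    by (simp_all add: companion_L_def numeral_eq_Suc)
  show ?thesis
    using L_poly_rec_step2[of m] L_poly_rec_step2[of "m + 2"] unfolding * by algebra
qed

lemma M_frac_eq: "M_frac (Suc k) = to_fract (companion_L (Suc k))"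
proof (induction k rule: induct_nat_012)
  case 0
  show ?case
    using L_poly_duplication[of 1] by (simp add: L_poly_nonzero)
next
  case 1
  have "L_poly 9 = L_poly 4 * companion_L (Suc (Suc 0))"
    using L_poly_duplication[of 2] by (simp flip: numeral_2_eq_2)
  then show ?case
    by (simp add: L_poly_nonzero)
next
  case (ge2 k)
  have "companion_L (Suc (Suc (Suc k)))
      = (5 + 4 * q) * companion_L (Suc (Suc k)) + (- 4 * (q - 1)\<^sup>2) * companion_L (Suc k)"
    using companion_L_rec[of "Suc k"] by simp
  then show ?case
    by (simp only: M_frac.simps ge2 to_fract_add to_fract_mult)
qed

theorem theorem3p2:
  fixes n :: nat
  assumes "n \<ge> 1"
  shows "to_fract (L_poly (4 * n + 1)) = to_fract (L_poly (2 * n)) * M_frac n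
         \<and> L_poly (2 * n) dvd L_poly (4 * n + 1)"
proof -
  obtain k where "n = Suc k"
    using assms by (cases n) auto
  then have "M_frac n = to_fract (companion_L n)"
    by (simp only: M_frac_eq)
  then show ?thesis
    by (simp only: L_poly_duplication[OF assms] to_fract_mult dvd_triv_left simp_thms)
qed

end
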